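(* Let $C:\mathcal X\to\{1,\dots,M\}$ be a coarsening function. Let $\mathcal F$ be the space of functions $f:\mathcal X\to\mathbb R$ that are constant on each stratum $C^{-1}(j)$, $j=1,\dots,M$, with $\|f\|=\sup_{x\in\mathcal X}|f(x)|$ for $f\in\mathcal F$ and $\|f\|=\infty$ otherwise, and let $\mathcal W_0=\mathcal W_0^{\text{probability}}$. Then, assuming no extrapolation, coarsened exact matching (CEM) with coarsening function $C$ is error-dual-norm minimizing (EDNM) with $(\mathcal F,\|\cdot\|)$ and this $\mathcal W_0$.
   Context: Data: covariates $X=(X_1,\dots,X_n)$ with $X_i\in\mathcal X$ and treatment indicators $T\in\{0,1\}^n$; $\mathcal T_t=\{i:T_i=t\}$, $n_t=|\mathcal T_t|\ge1$. The space of allowable weights is $\mathcal W=\mathcal W_0\times\mathcal W_1$: a weight vector $W\in\mathcal W$ always has $W_i=1/n_1$ for $i\in\mathcal T_1$ and $W_{\mathcal T_0}=(W_i)_{i\in\mathcal T_0}\in\mathcal W_0$; here $\mathcal W_0^{\text{probability}}=\{w\in\mathbb R_+^{\mathcal T_0}:\sum_{i\in\mathcal T_0}w_i=1\}$. The error operator is $\mathcal E(W;f)=\frac1{n_1}\sum_{i\in\mathcal T_1}f(X_i)-\sum_{i\in\mathcal T_0}W_if(X_i)$, which is invariant under adding constants to $f$. Given a space $\mathcal F$ of functions $\mathcal X\to\mathbb R$ with (semi)norm $\|\cdot\|$, put $\mathfrak E(W;\mathcal F)=\sup_{f\in\mathcal F,\ \|f\|\le1}\mathcal E(W;f)$ (the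 dual norm of the error). $\mathcal F/\mathbb R$ is the space of classes $[f]=\{f+c:c\in\mathbb R\}$ with norm $\|[f]\|=\min_{c\in\mathbb R}\|f+c\|$, and $\mathcal E(W;[f])=\mathcal E(W;f)$. EDNM: a matching method $W(T,X)$ is EDNM with $(\mathcal F,\|\cdot\|)$ and $\mathcal W$ if $\mathcal F/\mathbb R$ is a Banach space, $f\mapsto\mathcal E(W;f)$ is a continuous map from it to $\mathbb R$ for each $W\in\mathcal W$, and $$W(T,X)\in\operatorname{argmin}_{W\in\mathcal W}\mathfrak E(W;\mathcal F)\ne\mathcal W,$$ i.e. $W(T,X)$ is a minimizer and the set of minimizers is not all of $\mathcal W$. CEM: match exactly within each stratum $C^{-1}(j)$ by reweighting the control subjects so that each stratum has the same frequency in the weighted control sample as in the treated sample, with equal weights for control subjects in the same stratum; that is, $$W_i=\frac1{n_1}\,\frac{|\{i'\in\mathcal T_1:C(X_{i'})=C(X_i)\}|}{|\{i'\in\mathcal T_0:C(X_{i'})=C(X_i)\}|}\qquad(i\in\mathcal T_0).$$ "No extrapolation": no stratum contains treated subjects but no control subjects.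
   Formalization: EDNM's requirement that the minimizers are not all of W is claimed only when control subjects occupy at least two strata; if all lie in one stratum (e.g. M=1) every allowable weight has zero error and the claim is false. The other EDNM clauses hold unconditionally. *)

theory Defs
  imports "HOL-Analysis.Analysis"
begin

section \<open>Banach spaces on an explicit carrier\<close>

text \<open>The type class for Banach spaces speaks about whole types; a quotient of a space of
  functions needs a carrier-based version. The distance is set to zero off the carrier because
  the locale \<^locale>\<open>Metric_space\<close> wants it nonnegative and symmetric on the whole type.\<close>

definition norm_dist :: "'v set \<Rightarrow> ('v \<Rightarrow> 'v \<Rightarrow> 'v) \<Rightarrow> (real \<Rightarrow> 'v \<Rightarrow> 'v) \<Rightarrow> ('v \<Rightarrow> real) \<Rightarrow> 'v \<Rightarrow> 'v \<Rightarrow> real"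
  where "norm_dist V add smul nrm u v =
    (if u \<in> V \<and> v \<in> V then nrm (add u (smul (- 1) v)) else 0)"

locale banach_on =
  fixes V :: "'v set"
    and add :: "'v \<Rightarrow> 'v \<Rightarrow> 'v"
    and smul :: "real \<Rightarrow> 'v \<Rightarrow> 'v"
    and zero :: 'v
    and nrm :: "'v \<Rightarrow> real"
  assumes zero_closed: "zero \<in> V"
    and add_closed: "\<lbrakk>u \<in> V; v \<in> V\<rbrakk> \<Longrightarrow> add u v \<in> V"
    and smul_closed: "u \<in> V \<Longrightarrow> smul a u \<in> V"
    and add_assoc: "\<lbrakk>u \<in> V; v \<in> V; w \<in> V\<rbrakk> \<Longrightarrow> add (add u v) w = add u (add v w)"
    and add_commute: "\<lbrakk>u \<in> V; v \<in> V\<rbrakk> \<Longrightarrow> add u v = add v u"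
    and add_zero: "u \<in> V \<Longrightarrow> add u zero = u"
    and add_inverse: "u \<in> V \<Longrightarrow> add u (smul (- 1) u) = zero"
    and smul_one: "u \<in> V \<Longrightarrow> smul 1 u = u"
    and smul_smul: "u \<in> V \<Longrightarrow> smul a (smul b u) = smul (a * b) u"
    and smul_add_right: "\<lbrakk>u \<in> V; v \<in> V\<rbrakk> \<Longrightarrow> smul a (add u v) = add (smul a u) (smul a v)"
    and smul_add_left: "u \<in> V \<Longrightarrow> smul (a + b) u = add (smul a u) (smul b u)"
    and norm_nonneg: "u \<in> V \<Longrightarrow> 0 \<le> nrm u"
    and norm_eq_zero: "u \<in> V \<Longrightarrow> nrm u = 0 \<longleftrightarrow> u = zero"
    and norm_triangle: "\<lbrakk>u \<in> V; v \<in> V\<rbrakk> \<Longrightarrow> nrm (add u v) \<le> nrm u + nrm v"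
    and norm_smul: "u \<in> V \<Longrightarrow> nrm (smul a u) = \<bar>a\<bar> * nrm u"
    and complete: "Metric_space.mcomplete V (norm_dist V add smul nrm)"

section \<open>Function spaces modulo constants\<close>

text \<open>A function space is given by its carrier \<open>F\<close> together with an extended norm \<open>N\<close>, which is
  defined on all functions and may be infinite.\<close>

definition const_class :: "('x \<Rightarrow> real) \<Rightarrow> ('x \<Rightarrow> real) set"
  where "const_class f = {\<lambda>x. f x + c | c. True}"

definition quot_carrier :: "('x \<Rightarrow> real) set \<Rightarrow> ('x \<Rightarrow> real) set set"
  where "quot_carrier F = const_class ` F"

definition class_add :: "('x \<Rightarrow> real) set \<Rightarrow> ('x \<Rightarrow> real) set \<Rightarrow> ('x \<Rightarrow> real) set"
  where "class_add A B = {\<lambda>x. f x + g x | f g. f \<in> A \<and> g \<in> B}"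

text \<open>The added constant matters for \<open>a = 0\<close>: the multiple \<open>0 [f]\<close> has to be the class of all
  constants and not the single zero function.\<close>

definition class_scale :: "real \<Rightarrow> ('x \<Rightarrow> real) set \<Rightarrow> ('x \<Rightarrow> real) set"
  where "class_scale a A = {\<lambda>x. a * f x + c | f c. f \<in> A}"

definition class_norm :: "(('x \<Rightarrow> real) \<Rightarrow> ennreal) \<Rightarrow> ('x \<Rightarrow> real) set \<Rightarrow> ennreal"
  where "class_norm N A = (INF f\<in>A. N f)"

abbreviation class_rnorm :: "(('x \<Rightarrow> real) \<Rightarrow> ennreal) \<Rightarrow> ('x \<Rightarrow> real) set \<Rightarrow> real"
  where "class_rnorm N A \<equiv> enn2real (class_norm N A)"

text \<open>The quotient norm is meant as a minimum over the added constant; \<^const>\<open>class_norm\<close> takes an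
  infimum, so attainment is demanded here.\<close>

definition quot_banach :: "('x \<Rightarrow> real) set \<Rightarrow> (('x \<Rightarrow> real) \<Rightarrow> ennreal) \<Rightarrow> bool"
  where "quot_banach F N \<longleftrightarrow>
    (\<forall>A\<in>quot_carrier F. class_norm N A < \<infinity> \<and> (\<exists>f\<in>A. N f = class_norm N A)) \<and>
    banach_on (quot_carrier F) class_add class_scale (const_class (\<lambda>_. 0)) (class_rnorm N)"

definition quot_topology ::
    "('x \<Rightarrow> real) set \<Rightarrow> (('x \<Rightarrow> real) \<Rightarrow> ennreal) \<Rightarrow> ('x \<Rightarrow> real) set topology"
  where "quot_topology F N =
    Metric_space.mtopology (quot_carrier F)
      (norm_dist (quot_carrier F) class_add class_scale (class_rnorm N))"

section \<open>Weights and error\<close>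

text \<open>Subjects are indexed by a finite type \<open>'i\<close>; \<open>T i\<close> means that subject \<open>i\<close> is treated.\<close>

definition treated :: "('i \<Rightarrow> bool) \<Rightarrow> 'i set"
  where "treated T = {i. T i}"

definition control :: "('i \<Rightarrow> bool) \<Rightarrow> 'i set"
  where "control T = {i. \<not> T i}"

text \<open>Elements of \<open>W0\<close> are vectors indexed by the control subjects, encoded as functions that are
  \<^const>\<open>undefined\<close> outside \<^term>\<open>control T\<close>.\<close>

definition allowable_weights :: "('i \<Rightarrow> bool) \<Rightarrow> ('i \<Rightarrow> real) set \<Rightarrow> ('i \<Rightarrow> real) set"
  where "allowable_weights T W0 =
    {W. (\<forall>i\<in>treated T. W i = 1 / real (card (treated T))) \<and> restrict W (control T) \<in> W0}"

definition probability_weights :: "('i \<Rightarrow> bool) \<Rightarrow> ('i \<Rightarrow> real) set"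
  where "probability_weights T =
    {w \<in> control T \<rightarrow>\<^sub>E {0..}. (\<Sum>i\<in>control T. w i) = 1}"

definition matching_error ::
    "('i \<Rightarrow> bool) \<Rightarrow> ('i \<Rightarrow> 'x) \<Rightarrow> ('i \<Rightarrow> real) \<Rightarrow> ('x \<Rightarrow> real) \<Rightarrow> real"
  where "matching_error T X W f =
    1 / real (card (treated T)) * (\<Sum>i\<in>treated T. f (X i)) - (\<Sum>i\<in>control T. W i * f (X i))"

text \<open>For weights whose control part sums to one the error is the same for all members of a class.\<close>

definition class_error ::
    "('i \<Rightarrow> bool) \<Rightarrow> ('i \<Rightarrow> 'x) \<Rightarrow> ('i \<Rightarrow> real) \<Rightarrow> ('x \<Rightarrow> real) set \<Rightarrow> real"
  where "class_error T X W A = the_elem (matching_error T X W ` A)"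

definition error_dual_norm ::
    "('x \<Rightarrow> real) set \<Rightarrow> (('x \<Rightarrow> real) \<Rightarrow> ennreal) \<Rightarrow> ('i \<Rightarrow> bool) \<Rightarrow> ('i \<Rightarrow> 'x) \<Rightarrow>
      ('i \<Rightarrow> real) \<Rightarrow> ereal"
  where "error_dual_norm F N T X W =
    (SUP f\<in>{f \<in> F. N f \<le> 1}. ereal (matching_error T X W f))"

section \<open>Error-dual-norm minimization\<close>

definition dual_norm_setting ::
    "('x \<Rightarrow> real) set \<Rightarrow> (('x \<Rightarrow> real) \<Rightarrow> ennreal) \<Rightarrow> ('i \<Rightarrow> real) set \<Rightarrow>
      ('i \<Rightarrow> bool) \<Rightarrow> ('i \<Rightarrow> 'x) \<Rightarrow> bool"
  where "dual_norm_setting F N W0 T X \<longleftrightarrow>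
    quot_banach F N \<and>
    (\<forall>W\<in>allowable_weights T W0.
      continuous_map (quot_topology F N) euclideanreal (class_error T X W))"

definition dual_norm_minimizers ::
    "('x \<Rightarrow> real) set \<Rightarrow> (('x \<Rightarrow> real) \<Rightarrow> ennreal) \<Rightarrow> ('i \<Rightarrow> real) set \<Rightarrow>
      ('i \<Rightarrow> bool) \<Rightarrow> ('i \<Rightarrow> 'x) \<Rightarrow> ('i \<Rightarrow> real) set"
  where "dual_norm_minimizers F N W0 T X =
    {W. is_arg_min (error_dual_norm F N T X) (\<lambda>W. W \<in> allowable_weights T W0) W}"

definition ednm ::
    "('x \<Rightarrow> real) set \<Rightarrow> (('x \<Rightarrow> real) \<Rightarrow> ennreal) \<Rightarrow> ('i \<Rightarrow> real) set \<Rightarrow>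
      ('i \<Rightarrow> bool) \<Rightarrow> ('i \<Rightarrow> 'x) \<Rightarrow> ('i \<Rightarrow> real) \<Rightarrow> bool"
  where "ednm F N W0 T X W \<longleftrightarrow>
    dual_norm_setting F N W0 T X \<and>
    W \<in> dual_norm_minimizers F N W0 T X \<and>
    dual_norm_minimizers F N W0 T X \<noteq> allowable_weights T W0"

section \<open>Coarsened exact matching\<close>

definition stratum_functions :: "nat \<Rightarrow> ('x \<Rightarrow> nat) \<Rightarrow> ('x \<Rightarrow> real) set"
  where "stratum_functions M C = {f. \<forall>j\<in>{1..M}. f constant_on (C -` {j})}"

definition stratum_norm :: "nat \<Rightarrow> ('x \<Rightarrow> nat) \<Rightarrow> ('x \<Rightarrow> real) \<Rightarrow> ennreal"
  where "stratum_norm M C f =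
    (if f \<in> stratum_functions M C then (SUP x. ennreal \<bar>f x\<bar>) else \<infinity>)"

definition cem_weights :: "('x \<Rightarrow> nat) \<Rightarrow> ('i \<Rightarrow> bool) \<Rightarrow> ('i \<Rightarrow> 'x) \<Rightarrow> 'i \<Rightarrow> real"
  where "cem_weights C T X i =
    (if i \<in> treated T then 1 / real (card (treated T))
     else 1 / real (card (treated T)) *
       (real (card {k \<in> treated T. C (X k) = C (X i)}) /
        real (card {k \<in> control T. C (X k) = C (X i)})))"

definition no_extrapolation :: "('x \<Rightarrow> nat) \<Rightarrow> ('i \<Rightarrow> bool) \<Rightarrow> ('i \<Rightarrow> 'x) \<Rightarrow> bool"
  where "no_extrapolation C T X \<longleftrightarrow>
    (\<forall>i\<in>treated T. \<exists>k\<in>control T. C (X k) = C (X i))"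

text \<open>If all control subjects lie in one stratum, the error at a function that is constant on
  strata does not depend on the weights, so that every allowable weight vector is a minimizer.\<close>

definition controls_in_two_strata :: "('x \<Rightarrow> nat) \<Rightarrow> ('i \<Rightarrow> bool) \<Rightarrow> ('i \<Rightarrow> 'x) \<Rightarrow> bool"
  where "controls_in_two_strata C T X \<longleftrightarrow>
    (\<exists>i\<in>control T. \<exists>k\<in>control T. C (X i) \<noteq> C (X k))"

end

theory Submission
  imports Defs
begin

text \<open>Functions constant on the strata take finitely many values, and the class of such an \<open>f\<close> has
  norm half the oscillation of \<open>f\<close>; completeness modulo constants follows by normalizing
  representatives to vanish at one point. CEM makes the error of every function in the space zero,
  while the dual norm is nonnegative because the zero function competes. If the controls meet two
  strata, the two point masses at controls in different strata give the indicator of one of the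
  strata different errors, so that not both are minimizers.\<close>

section \<open>Half the oscillation of a function\<close>

text \<open>The supremum-norm distance from \<open>f\<close> to the constants. It is used only for
  functions of finite range, where \<open>Max\<close> and \<open>Min\<close> are attained.\<close>

definition half_osc :: "('a \<Rightarrow> real) \<Rightarrow> real"
  where "half_osc f = (Max (range f) - Min (range f)) / 2"

text \<open>The extreme values are attained, so the largest difference of two values is the full
  oscillation. Most later estimates use this pairwise form instead of \<open>Max\<close> and
  \<open>Min\<close>.\<close>

lemma half_osc_le_iff:
  assumes "finite (range f)"
  shows "half_osc f \<le> r \<longleftrightarrow> (\<forall>x y. f x - f y \<le> 2 * r)"
proof
  assume "half_osc f \<le> r"
  then have "Max (range f) - Min (range f) \<le> 2 * r"
    by (simp add: half_osc_def)
  moreover have "f x \<le> Max (range f)" "Min (range f) \<le> f y" for x y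
    using assms by simp_all
  ultimately show "\<forall>x y. f x - f y \<le> 2 * r"
    by (smt (verit))
next
  assume *: "\<forall>x y. f x - f y \<le> 2 * r"
  obtain x y where "f x = Max (range f)" "f y = Min (range f)"
    using Max_in[OF assms] Min_in[OF assms] by fastforce
  then show "half_osc f \<le> r"
    using *[rule_format, of x y] by (simp add: half_osc_def)
qed

lemma diff_le_half_osc: "finite (range f) \<Longrightarrow> f x - f y \<le> 2 * half_osc f"
  using half_osc_le_iff[of f "half_osc f"] by blast

lemma half_osc_nonneg: "finite (range f) \<Longrightarrow> 0 \<le> half_osc f"
  using diff_le_half_osc[of f undefined undefined] by simp

lemma half_osc_eq_0_iff:
  assumes "finite (range f)"
  shows "half_osc f = 0 \<longleftrightarrow> (\<forall>x y. f x = f y)"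
proof -
  have "half_osc f = 0 \<longleftrightarrow> half_osc f \<le> 0"
    using half_osc_nonneg[OF assms] by linarith
  also have "\<dots> \<longleftrightarrow> (\<forall>x y. f x - f y \<le> 0)"
    using half_osc_le_iff[OF assms, of 0] by simp
  also have "\<dots> \<longleftrightarrow> (\<forall>x y. f x = f y)"
    by (metis diff_le_0_iff_le order_antisym order_refl)
  finally show ?thesis .
qed

lemma half_osc_add_le:
  assumes "finite (range f)" "finite (range g)" "finite (range (\<lambda>x. f x + g x))"
  shows "half_osc (\<lambda>x. f x + g x) \<le> half_osc f + half_osc g"
proof -
  have "(f x + g x) - (f y + g y) \<le> 2 * (half_osc f + half_osc g)" for x y
    using diff_le_half_osc[OF assms(1), of x y] diff_le_half_osc[OF assms(2), of x y] by simp
  then show ?thesis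
    using half_osc_le_iff[OF assms(3)] by blast
qed

lemma half_osc_mult:
  assumes "finite (range f)" "finite (range (\<lambda>x. a * f x))"
  shows "half_osc (\<lambda>x. a * f x) = \<bar>a\<bar> * half_osc f"
proof (rule antisym)
  have abs_le: "\<bar>f x - f y\<bar> \<le> 2 * half_osc f" for x y
    using diff_le_half_osc[OF assms(1), of x y] diff_le_half_osc[OF assms(1), of y x] by linarith
  have "a * f x - a * f y \<le> 2 * (\<bar>a\<bar> * half_osc f)" for x y
  proof -
    have "a * f x - a * f y \<le> \<bar>a\<bar> * \<bar>f x - f y\<bar>"
      by (metis abs_ge_self abs_mult right_diff_distrib)
    also have "\<dots> \<le> \<bar>a\<bar> * (2 * half_osc f)"
      by (intro mult_left_mono abs_le) simp
    finally show ?thesis by simp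
  qed
  then show "half_osc (\<lambda>x. a * f x) \<le> \<bar>a\<bar> * half_osc f"
    using half_osc_le_iff[OF assms(2)] by blast
  show "\<bar>a\<bar> * half_osc f \<le> half_osc (\<lambda>x. a * f x)"
  proof (cases "a = 0")
    case True
    then show ?thesis by (simp add: half_osc_def)
  next
    case False
    have "f x - f y \<le> 2 * (half_osc (\<lambda>x. a * f x) / \<bar>a\<bar>)" for x y
    proof -
      \<comment> \<open>For negative \<open>a\<close> the relevant difference of
        \<open>a * f\<close> is the one with \<open>x\<close> and \<open>y\<close> swapped, hence
        both orders.\<close>
      have "\<bar>a\<bar> * (f x - f y) \<le> 2 * half_osc (\<lambda>x. a * f x)"
        using diff_le_half_osc[OF assms(2), of x y] diff_le_half_osc[OF assms(2), of y x]
        by (auto simp: abs_if algebra_simps)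
      then show ?thesis
        using False by (simp add: field_simps)
    qed
    then have "half_osc f \<le> half_osc (\<lambda>x. a * f x) / \<bar>a\<bar>"
      using half_osc_le_iff[OF assms(1)] by blast
    then show ?thesis
      using False by (simp add: field_simps)
  qed
qed

section \<open>Classes modulo constants\<close>

lemma const_class_eq_iff:
  "const_class f = const_class g \<longleftrightarrow> (\<exists>c. \<forall>x. f x = g x + c)"
proof
  assume "const_class f = const_class g"
  moreover have "f \<in> const_class f"
    by (auto simp: const_class_def intro!: exI[of _ 0])
  ultimately show "\<exists>c. \<forall>x. f x = g x + c"
    by (auto simp: const_class_def)
next
  assume "\<exists>c. \<forall>x. f x = g x + c"
  then obtain c where c: "f = (\<lambda>x. g x + c)"
    by auto
  have "\<exists>d. (\<lambda>x. g x + e) = (\<lambda>x. g x + c + d)" for e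
    by (rule exI[of _ "e - c"]) auto
  moreover have "\<exists>d. (\<lambda>x. g x + c + e) = (\<lambda>x. g x + d)" for e
    by (rule exI[of _ "c + e"]) auto
  ultimately show "const_class f = const_class g"
    unfolding const_class_def c by blast
qed

text \<open>Moves the set operation to representatives, so that the vector space laws of the
  quotient become pointwise identities.\<close>

lemma class_add_const_class:
  "class_add (const_class f) (const_class g) = const_class (\<lambda>x. f x + g x)"
proof (intro set_eqI iffI)
  fix h assume "h \<in> class_add (const_class f) (const_class g)"
  then obtain c d where "h = (\<lambda>x. f x + c + (g x + d))"
    by (auto simp: class_add_def const_class_def)
  then have "h = (\<lambda>x. f x + g x + (c + d))"
    by (simp add: algebra_simps)
  then show "h \<in> const_class (\<lambda>x. f x + g x)"
    by (auto simp: const_class_def)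
next
  fix h assume "h \<in> const_class (\<lambda>x. f x + g x)"
  then obtain c where "h = (\<lambda>x. f x + g x + c)"
    by (auto simp: const_class_def)
  then have "h = (\<lambda>x. (f x + 0) + (g x + c))"
    by (simp add: algebra_simps)
  then show "h \<in> class_add (const_class f) (const_class g)"
    unfolding class_add_def const_class_def by fastforce
qed

lemma class_scale_const_class:
  "class_scale a (const_class f) = const_class (\<lambda>x. a * f x)"
proof (intro set_eqI iffI)
  fix h assume "h \<in> class_scale a (const_class f)"
  then obtain c d where "h = (\<lambda>x. a * (f x + c) + d)"
    by (auto simp: class_scale_def const_class_def)
  then have "h = (\<lambda>x. a * f x + (a * c + d))"
    by (simp add: algebra_simps)
  then show "h \<in> const_class (\<lambda>x. a * f x)"
    by (auto simp: const_class_def)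
next
  fix h assume "h \<in> const_class (\<lambda>x. a * f x)"
  \<comment> \<open>The representative \<open>f\<close> itself and the free constant of
    \<open>class_scale\<close> suffice, which covers \<open>a = 0\<close> as well.\<close>
  then obtain c where "h = (\<lambda>x. a * (f x + 0) + c)"
    by (auto simp: const_class_def)
  then show "h \<in> class_scale a (const_class f)"
    unfolding class_scale_def const_class_def by fastforce
qed

section \<open>Functions constant on strata\<close>

locale coarsening =
  fixes M :: nat and C :: "'x \<Rightarrow> nat"
  assumes coarsening: "C x \<in> {1..M}"
begin

abbreviation "F \<equiv> stratum_functions M C"
abbreviation "N \<equiv> stratum_norm M C"
abbreviation "Q \<equiv> quot_carrier F"
abbreviation "d \<equiv> norm_dist Q class_add class_scale (class_rnorm N)"

text \<open>Every point lies in a stratum with index in \<open>{1..M}\<close>, and an empty stratum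
  imposes no condition, so the index can be eliminated.\<close>

lemma mem_iff: "f \<in> F \<longleftrightarrow> (\<forall>x y. C x = C y \<longrightarrow> f x = f y)"
proof
  assume f: "f \<in> F"
  show "\<forall>x y. C x = C y \<longrightarrow> f x = f y"
  proof (intro allI impI)
    fix x y assume "C x = C y"
    moreover have "f constant_on (C -` {C x})"
      using f coarsening[of x] by (auto simp: stratum_functions_def)
    ultimately show "f x = f y"
      by (auto simp: constant_on_def)
  qed
next
  assume *: "\<forall>x y. C x = C y \<longrightarrow> f x = f y"
  have "f constant_on (C -` {j})" for j
  proof (cases "C -` {j} = {}")
    case True
    then show ?thesis by (simp add: constant_on_def)
  next
    case False
    then obtain y where "C y = j" by auto
    then have "\<forall>x\<in>C -` {j}. f x = f y"
      using * by auto
    then show ?thesis unfolding constant_on_def by blast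
  qed
  then show "f \<in> F" by (simp add: stratum_functions_def)
qed

lemma finite_range:
  assumes "f \<in> F"
  shows "finite (range f)"
proof -
  \<comment> \<open>\<open>inv C\<close> selects one point of each nonempty stratum, so
    \<open>f\<close> factors through \<open>C\<close>, which has at most \<open>M\<close>
    values.\<close>
  have "f x = f (inv C (C x))" for x
    using assms unfolding mem_iff by (metis f_inv_into_f rangeI)
  then have "range f \<subseteq> (\<lambda>j. f (inv C j)) ` range C"
    by blast
  moreover have "finite (range C)"
    using coarsening by (meson finite_atLeastAtMost finite_subset image_subsetI)
  ultimately show ?thesis
    by (meson finite_imageI finite_subset)
qed

lemma zero_mem: "(\<lambda>_. 0) \<in> F"
  and add_mem: "f \<in> F \<Longrightarrow> g \<in> F \<Longrightarrow> (\<lambda>x. f x + g x) \<in> F"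
  and diff_mem: "f \<in> F \<Longrightarrow> g \<in> F \<Longrightarrow> (\<lambda>x. f x - g x) \<in> F"
  and mult_mem: "f \<in> F \<Longrightarrow> (\<lambda>x. a * f x) \<in> F"
  and shift_mem: "f \<in> F \<Longrightarrow> (\<lambda>x. f x + c) \<in> F"
  unfolding mem_iff by metis+

lemma norm_le_iff:
  assumes "f \<in> F" "0 \<le> r"
  shows "N f \<le> ennreal r \<longleftrightarrow> (\<forall>x. \<bar>f x\<bar> \<le> r)"
  using assms by (simp add: stratum_norm_def SUP_le_iff)

text \<open>Differences do not see an added constant: a shift of \<open>f\<close> bounded by
  \<open>r\<close> forces all differences of \<open>f\<close> below \<open>2 * r\<close>. The shift
  centring the range of \<open>f\<close> at zero reaches this bound.\<close>

lemma class_norm_attained: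
  assumes f: "f \<in> F"
  shows "class_norm N (const_class f) = ennreal (half_osc f)"
    and "\<exists>g\<in>const_class f. N g = ennreal (half_osc f)"
proof -
  note fin = finite_range[OF f]
  have lower: "ennreal (half_osc f) \<le> N g" if g: "g \<in> const_class f" for g
  proof -
    obtain c where g_eq: "g = (\<lambda>x. f x + c)"
      using g by (auto simp: const_class_def)
    have gF: "g \<in> F"
      unfolding g_eq using f by (rule shift_mem)
    show ?thesis
    proof (cases "N g")
      case (real r)
      then have "\<bar>g x\<bar> \<le> r" for x
        using norm_le_iff[OF gF, of r] by simp
      then have "f x - f y \<le> 2 * r" for x y
        unfolding g_eq by (smt (verit))
      then show ?thesis
        using half_osc_le_iff[OF fin] real by (simp add: ennreal_leI)
    qed simp
  qed
  \<comment> \<open>the midrange of \<open>f\<close> is the optimal constant\<close>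
  define g where "g = (\<lambda>x. f x + - (Max (range f) + Min (range f)) / 2)"
  have g: "g \<in> const_class f"
    by (auto simp: g_def const_class_def)
  have gF: "g \<in> F"
    unfolding g_def using f by (rule shift_mem)
  have "\<bar>g x\<bar> \<le> half_osc f" for x
  proof -
    have "f x \<le> Max (range f)" "Min (range f) \<le> f x"
      using fin by simp_all
    then show ?thesis
      by (simp add: g_def half_osc_def abs_le_iff field_simps)
  qed
  then have "N g \<le> ennreal (half_osc f)"
    using norm_le_iff[OF gF half_osc_nonneg[OF fin]] by blast
  with lower[OF g] have Ng: "N g = ennreal (half_osc f)"
    by (rule antisym[rotated])
  then show "\<exists>g\<in>const_class f. N g = ennreal (half_osc f)"
    using g by blast
  show "class_norm N (const_class f) = ennreal (half_osc f)"
    unfolding class_norm_def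
    by (rule antisym) (use g Ng lower in \<open>auto intro: INF_lower2 INF_greatest\<close>)
qed

lemma class_rnorm_eq: "f \<in> F \<Longrightarrow> class_rnorm N (const_class f) = half_osc f"
  by (simp add: class_norm_attained half_osc_nonneg finite_range)

lemma const_class_mem: "f \<in> F \<Longrightarrow> const_class f \<in> Q"
  by (simp add: quot_carrier_def)

section \<open>The quotient metric and its completeness\<close>

lemma dist_eq:
  assumes "f \<in> F" "g \<in> F"
  shows "d (const_class f) (const_class g) = half_osc (\<lambda>x. f x - g x)"
  using assms class_rnorm_eq[OF diff_mem[OF assms]]
  by (simp add: norm_dist_def const_class_mem class_scale_const_class class_add_const_class)

lemma half_osc_diff_le_iff:
  assumes "f \<in> F" "g \<in> F"
  shows "half_osc (\<lambda>x. f x - g x) \<le> r \<longleftrightarrow> (\<forall>x y. (f x - g x) - (f y - g y) \<le> 2 * r)"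
  by (rule half_osc_le_iff[OF finite_range[OF diff_mem[OF assms]]])

lemma half_osc_diff:
  assumes "f \<in> F" "g \<in> F"
  shows "(f x - g x) - (f y - g y) \<le> 2 * half_osc (\<lambda>x. f x - g x)"
  using half_osc_diff_le_iff[OF assms] by blast

lemma metric: "Metric_space Q d"
proof
  show "0 \<le> d u v" for u v
    by (simp add: norm_dist_def)
  have sym: "d (const_class f) (const_class g) \<le> d (const_class g) (const_class f)"
    if "f \<in> F" "g \<in> F" for f g
  proof -
    have "(f x - g x) - (f y - g y) \<le> 2 * half_osc (\<lambda>x. g x - f x)" for x y
      using half_osc_diff[OF that(2,1), of y x] by linarith
    then show ?thesis
      by (simp add: dist_eq that half_osc_diff_le_iff)
  qed
  show "d u v = d v u" for u v
  proof (cases "u \<in> Q \<and> v \<in> Q")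
    case True
    then show ?thesis
      using sym by (auto simp: quot_carrier_def intro: antisym)
  qed (auto simp: norm_dist_def)
  show "d u v = 0 \<longleftrightarrow> u = v" if "u \<in> Q" "v \<in> Q" for u v
  proof -
    obtain f g where fg: "f \<in> F" "g \<in> F" and uv: "u = const_class f" "v = const_class g"
      using \<open>u \<in> Q\<close> \<open>v \<in> Q\<close> by (auto simp: quot_carrier_def)
    have "(\<forall>x y. f x - g x = f y - g y) \<longleftrightarrow> (\<exists>c. \<forall>x. f x = g x + c)"
      by (metis add.commute diff_add_cancel add_diff_cancel_left')
    then show ?thesis
      unfolding uv dist_eq[OF fg] const_class_eq_iff
      using half_osc_eq_0_iff[OF finite_range[OF diff_mem[OF fg]]] by simp
  qed
  show "d u w \<le> d u v + d v w" if "u \<in> Q" "v \<in> Q" "w \<in> Q" for u v w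
  proof -
    obtain f g h where fgh: "f \<in> F" "g \<in> F" "h \<in> F"
      and uvw: "u = const_class f" "v = const_class g" "w = const_class h"
      using \<open>u \<in> Q\<close> \<open>v \<in> Q\<close> \<open>w \<in> Q\<close> by (auto simp: quot_carrier_def)
    have "half_osc (\<lambda>x. (f x - g x) + (g x - h x))
        \<le> half_osc (\<lambda>x. f x - g x) + half_osc (\<lambda>x. g x - h x)"
      by (intro half_osc_add_le finite_range add_mem diff_mem fgh)
    then show ?thesis
      by (simp add: uvw dist_eq fgh)
  qed
qed

interpretation Metric_space Q d
  by (rule metric)

text \<open>For representatives vanishing at a base point, a difference \<open>h\<close> satisfies
  \<open>h x = h x - h x0\<close>, so the oscillation bounds the supremum norm. A Cauchy sequence of
  classes thus becomes uniformly Cauchy, and its pointwise limit represents the limit class.\<close>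

lemma complete: mcomplete
  unfolding mcomplete_def
proof (intro allI impI)
  fix \<sigma> :: "nat \<Rightarrow> ('x \<Rightarrow> real) set" assume \<sigma>: "MCauchy \<sigma>"
  fix x0 :: 'x
  have "\<exists>f\<in>F. const_class f = \<sigma> n \<and> f x0 = 0" for n
  proof -
    have "\<sigma> n \<in> Q"
      using \<sigma> by (auto simp: MCauchy_def)
    then obtain f where f: "f \<in> F" "\<sigma> n = const_class f"
      by (auto simp: quot_carrier_def)
    have "const_class (\<lambda>x. f x + - f x0) = \<sigma> n"
      unfolding f(2) const_class_eq_iff by auto
    then show ?thesis
      using shift_mem[OF f(1), of "- f x0"] by force
  qed
  then obtain f where fF: "\<And>n. f n \<in> F" and f\<sigma>: "\<And>n. const_class (f n) = \<sigma> n"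
    and f0: "\<And>n. f n x0 = 0"
    by metis
  have close: "\<exists>K. \<forall>m\<ge>K. \<forall>n\<ge>K. \<forall>x. \<bar>f m x - f n x\<bar> < e" if "e > 0" for e
  proof -
    obtain K where K: "\<And>m n. m \<ge> K \<Longrightarrow> n \<ge> K \<Longrightarrow> d (\<sigma> m) (\<sigma> n) < e / 2"
      using \<sigma> \<open>e > 0\<close> unfolding MCauchy_def by (meson half_gt_zero)
    have "\<bar>f m x - f n x\<bar> < e" if "m \<ge> K" "n \<ge> K" for m n x
    proof -
      \<comment> \<open>Half the oscillation below \<open>e / 2\<close> means all differences are
        below \<open>e\<close>; comparing \<open>x\<close> with \<open>x0\<close> in both orders
        bounds the absolute value.\<close>
      have "half_osc (\<lambda>x. f m x - f n x) < e / 2"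
        using K[OF that] by (simp add: dist_eq fF flip: f\<sigma>)
      then show ?thesis
        using half_osc_diff[OF fF fF, of m x n x0] half_osc_diff[OF fF fF, of m x0 n x] f0
        by (simp add: abs_less_iff)
    qed
    then show ?thesis by blast
  qed
  have "convergent (\<lambda>n. f n x)" for x
  proof (rule Cauchy_convergent, rule metric_CauchyI)
    fix e :: real assume "e > 0"
    then show "\<exists>K. \<forall>m\<ge>K. \<forall>n\<ge>K. dist (f m x) (f n x) < e"
      using close[of e] unfolding dist_real_def by blast
  qed
  then obtain g where lim: "\<And>x. (\<lambda>n. f n x) \<longlonglongrightarrow> g x"
    unfolding convergent_def by metis
  have gF: "g \<in> F"
    unfolding mem_iff
  proof (intro allI impI)
    fix x y assume "C x = C y"
    then have "(\<lambda>n. f n x) = (\<lambda>n. f n y)"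
      using fF unfolding mem_iff by blast
    then show "g x = g y"
      using lim[of x] lim[of y] by (auto intro: LIMSEQ_unique)
  qed
  have "\<exists>K. \<forall>n\<ge>K. \<sigma> n \<in> Q \<and> d (\<sigma> n) (const_class g) < e" if e: "e > 0" for e
  proof -
    obtain K where K: "\<And>m n x. m \<ge> K \<Longrightarrow> n \<ge> K \<Longrightarrow> \<bar>f m x - f n x\<bar> < e / 2"
      using close[of "e / 2"] e by auto
    have "d (\<sigma> n) (const_class g) < e" if n: "n \<ge> K" for n
    proof -
      \<comment> \<open>Let \<open>m\<close> tend to infinity in the uniform Cauchy estimate; the
        strict bound becomes a weak one. Starting from \<open>e / 2\<close> keeps the final
        inequality strict.\<close>
      have "\<bar>f n x - g x\<bar> \<le> e / 2" for x
      proof (rule tendsto_upperbound)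
        show "(\<lambda>m. \<bar>f n x - f m x\<bar>) \<longlonglongrightarrow> \<bar>f n x - g x\<bar>"
          by (intro tendsto_intros lim)
        show "\<forall>\<^sub>F m in sequentially. \<bar>f n x - f m x\<bar> \<le> e / 2"
          using K[OF n] by (auto simp: eventually_sequentially intro: less_imp_le)
      qed simp
      then have "(f n x - g x) - (f n y - g y) \<le> 2 * (e / 2)" for x y
        by (smt (verit) field_sum_of_halves)
      then have "half_osc (\<lambda>x. f n x - g x) \<le> e / 2"
        using half_osc_diff_le_iff[OF fF gF] by blast
      then show ?thesis
        using e by (simp add: dist_eq fF gF flip: f\<sigma>)
    qed
    then show ?thesis
      using const_class_mem[OF fF] f\<sigma> by auto
  qed
  then have "limitin mtopology \<sigma> (const_class g) sequentially"
    unfolding limit_metric_sequentially using const_class_mem[OF gF] by blast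
  then show "\<exists>A. limitin mtopology \<sigma> A sequentially" ..
qed

text \<open>Finiteness and attainment come from the midrange representative, the algebraic laws hold
  on representatives, and the norm laws are those of \<open>half_osc\<close>.\<close>

lemma quot_banach: "quot_banach F N"
  unfolding quot_banach_def
proof (intro conjI ballI)
  fix A assume "A \<in> Q"
  then obtain f where "f \<in> F" "A = const_class f"
    by (auto simp: quot_carrier_def)
  then show "class_norm N A < \<infinity>" "\<exists>f\<in>A. N f = class_norm N A"
    using class_norm_attained[of f] by simp_all
next
  note cls = class_add_const_class class_scale_const_class
  show "banach_on Q class_add class_scale (const_class (\<lambda>_. 0)) (class_rnorm N)"
  proof
    show "const_class (\<lambda>_. 0) \<in> Q"
      by (rule const_class_mem[OF zero_mem])
    show "mcomplete"
      by (rule complete)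
    fix u assume "u \<in> Q"
    then obtain f where f: "f \<in> F" "u = const_class f"
      by (auto simp: quot_carrier_def)
    note fin = finite_range[OF f(1)]
    show "class_scale a u \<in> Q" for a
      using f by (simp add: cls const_class_mem mult_mem)
    show "class_add u (const_class (\<lambda>_. 0)) = u" "class_scale 1 u = u"
      "class_add u (class_scale (- 1) u) = const_class (\<lambda>_. 0)"
      by (simp_all add: f cls)
    show "class_scale a (class_scale b u) = class_scale (a * b) u"
      "class_scale (a + b) u = class_add (class_scale a u) (class_scale b u)" for a b
      by (simp_all add: f cls algebra_simps)
    show "0 \<le> class_rnorm N u"
      by simp
    show "class_rnorm N u = 0 \<longleftrightarrow> u = const_class (\<lambda>_. 0)"
      unfolding f(2) class_rnorm_eq[OF f(1)] half_osc_eq_0_iff[OF fin] const_class_eq_iff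
      by (metis add_0)
    show "class_rnorm N (class_scale a u) = \<bar>a\<bar> * class_rnorm N u" for a
      unfolding f(2) cls class_rnorm_eq[OF f(1)] class_rnorm_eq[OF mult_mem[OF f(1)]]
      by (intro half_osc_mult finite_range mult_mem f)
    fix v assume "v \<in> Q"
    then obtain g where g: "g \<in> F" "v = const_class g"
      by (auto simp: quot_carrier_def)
    show "class_add u v \<in> Q"
      using f g by (simp add: cls const_class_mem add_mem)
    show "class_add u v = class_add v u"
      "class_scale a (class_add u v) = class_add (class_scale a u) (class_scale a v)" for a
      by (simp_all add: f g cls algebra_simps)
    show "class_rnorm N (class_add u v) \<le> class_rnorm N u + class_rnorm N v"
      unfolding f(2) g(2) cls class_rnorm_eq[OF f(1)] class_rnorm_eq[OF g(1)]
        class_rnorm_eq[OF add_mem[OF f(1) g(1)]]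
      by (intro half_osc_add_le finite_range add_mem f g)
    fix w assume "w \<in> Q"
    then obtain h where "w = const_class h"
      by (auto simp: quot_carrier_def)
    then show "class_add (class_add u v) w = class_add u (class_add v w)"
      by (simp add: f g cls algebra_simps)
  qed
qed

end

section \<open>Errors\<close>

text \<open>Restriction to \<open>control T\<close> is automatically extensional, so only the
  numerical conditions remain.\<close>

lemma allowable_probability_weights_iff:
  "W \<in> allowable_weights T (probability_weights T) \<longleftrightarrow>
    (\<forall>i\<in>treated T. W i = 1 / real (card (treated T))) \<and>
    (\<forall>i\<in>control T. 0 \<le> W i) \<and> (\<Sum>i\<in>control T. W i) = 1"
  by (auto simp: allowable_weights_def probability_weights_def PiE_iff extensional_def)

lemma matching_error_diff:
  "matching_error T X W (\<lambda>x. f x - g x) = matching_error T X W f - matching_error T X W g"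
  by (simp add: matching_error_def sum_subtractf algebra_simps)

lemma matching_error_uminus:
  "matching_error T X W (\<lambda>x. - f x) = - matching_error T X W f"
  using matching_error_diff[of T X W "\<lambda>_. 0" f] by (simp add: matching_error_def)

text \<open>The treated average and the control weights both have total mass one, so a constant
  cancels.\<close>

lemma matching_error_const:
  fixes T :: "'i::finite \<Rightarrow> bool"
  assumes "treated T \<noteq> {}" "(\<Sum>i\<in>control T. W i) = 1"
  shows "matching_error T X W (\<lambda>_. c) = 0"
proof -
  have "(\<Sum>i\<in>control T. W i * c) = c"
    using assms(2) by (simp flip: sum_distrib_right)
  then show ?thesis
    using assms(1) by (simp add: matching_error_def)
qed

text \<open>Both terms of the error are averages: the treated one is at most \<open>b\<close>, and
  the control one is at least \<open>a\<close>.\<close>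

lemma matching_error_le:
  fixes T :: "'i::finite \<Rightarrow> bool"
  assumes T: "treated T \<noteq> {}" and W: "\<And>i. i \<in> control T \<Longrightarrow> 0 \<le> W i" "(\<Sum>i\<in>control T. W i) = 1"
    and h: "\<And>x. a \<le> h x" "\<And>x. h x \<le> b"
  shows "matching_error T X W h \<le> b - a"
proof -
  have "(\<Sum>i\<in>treated T. h (X i)) \<le> real (card (treated T)) * b"
    using sum_bounded_above[of "treated T" "\<lambda>i. h (X i)" b] h by simp
  then have "1 / real (card (treated T)) * (\<Sum>i\<in>treated T. h (X i)) \<le> b"
    using T by (simp add: divide_le_eq card_gt_0_iff mult.commute)
  moreover have "(\<Sum>i\<in>control T. W i * a) \<le> (\<Sum>i\<in>control T. W i * h (X i))"
    by (intro sum_mono mult_left_mono h W)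
  then have "a \<le> (\<Sum>i\<in>control T. W i * h (X i))"
    using W(2) by (simp flip: sum_distrib_right)
  ultimately show ?thesis
    by (simp add: matching_error_def)
qed

text \<open>Adding a constant leaves the error unchanged, so the image of the class is a singleton
  and \<open>the_elem\<close> returns its element.\<close>

lemma class_error_const_class:
  fixes T :: "'i::finite \<Rightarrow> bool"
  assumes "treated T \<noteq> {}" "(\<Sum>i\<in>control T. W i) = 1"
  shows "class_error T X W (const_class f) = matching_error T X W f"
proof -
  have "matching_error T X W (\<lambda>x. f x + c) = matching_error T X W f" for c
    using matching_error_diff[of T X W f "\<lambda>_. - c"] matching_error_const[OF assms] by simp
  then have "matching_error T X W ` const_class f = {matching_error T X W f}"
    by (auto simp: const_class_def image_iff intro!: exI[of _ f] exI[of _ 0])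
  then show ?thesis
    by (simp add: class_error_def)
qed

section \<open>Continuity of the error on the quotient space\<close>

context coarsening
begin

interpretation Metric_space Q d
  by (rule metric)

text \<open>The error of the difference of representatives is at most its oscillation, which is
  twice the distance of the classes; hence the factor 2.\<close>

lemma class_error_lipschitz:
  fixes T :: "'i::finite \<Rightarrow> bool"
  assumes T: "treated T \<noteq> {}" and W: "W \<in> allowable_weights T (probability_weights T)"
    and uv: "u \<in> Q" "v \<in> Q"
  shows "class_error T X W u - class_error T X W v \<le> 2 * d u v"
proof -
  obtain f g where f: "f \<in> F" "u = const_class f" and g: "g \<in> F" "v = const_class g"
    using uv by (auto simp: quot_carrier_def)
  define h where "h = (\<lambda>x. f x - g x)"
  have fin: "finite (range h)"
    unfolding h_def by (intro finite_range diff_mem f g)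
  have W': "\<And>i. i \<in> control T \<Longrightarrow> 0 \<le> W i" "(\<Sum>i\<in>control T. W i) = 1"
    using W unfolding allowable_probability_weights_iff by blast+
  have "matching_error T X W h \<le> Max (range h) - Min (range h)"
    using fin by (intro matching_error_le T W') simp_all
  then show ?thesis
    by (simp add: f g dist_eq class_error_const_class[OF T W'(2)] h_def half_osc_def
        matching_error_diff)
qed

lemma dual_norm_setting:
  fixes T :: "'i::finite \<Rightarrow> bool"
  assumes T: "treated T \<noteq> {}"
  shows "dual_norm_setting F N (probability_weights T) T X"
  unfolding dual_norm_setting_def
proof (intro conjI ballI quot_banach)
  fix W assume W: "W \<in> allowable_weights T (probability_weights T)"
  have "Lipschitz_continuous_map (metric (Q, d)) euclidean_metric (class_error T X W)"
    unfolding Lipschitz_continuous_map_def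
  proof (intro conjI exI[of _ 2] ballI)
    fix u v assume "u \<in> mspace (metric (Q, d))" "v \<in> mspace (metric (Q, d))"
    then have "u \<in> Q" "v \<in> Q" by simp_all
    then show "mdist euclidean_metric (class_error T X W u) (class_error T X W v)
        \<le> 2 * mdist (metric (Q, d)) u v"
      using class_error_lipschitz[OF T W, of u v X] class_error_lipschitz[OF T W, of v u X]
      by (simp add: dist_real_def abs_le_iff commute)
  qed simp
  from Lipschitz_continuous_imp_continuous_map[OF this]
  show "continuous_map (quot_topology F N) euclideanreal (class_error T X W)"
    by (simp add: quot_topology_def)
qed

end

section \<open>Coarsened exact matching\<close>

text \<open>Expand the treated count in each weight as a sum over treated subjects of the same
  stratum and swap the sums. The contribution of a treated subject is then split equally among the
  controls of its stratum and adds up again to the whole.\<close>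

lemma sum_cem_weights:
  fixes T :: "'i::finite \<Rightarrow> bool" and X :: "'i \<Rightarrow> 'x" and f :: "'x \<Rightarrow> real"
  assumes ne: "no_extrapolation C T X" and f: "\<And>x y. C x = C y \<Longrightarrow> f x = f y"
  shows "(\<Sum>i\<in>control T. cem_weights C T X i * f (X i)) =
    1 / real (card (treated T)) * (\<Sum>k\<in>treated T. f (X k))"
proof -
  let ?n = "real (card (treated T))"
  let ?m = "\<lambda>i. real (card {k \<in> control T. C (X k) = C (X i)})"
  have "(\<Sum>i\<in>control T. cem_weights C T X i * f (X i)) =
      (\<Sum>i\<in>control T. \<Sum>k | k \<in> treated T \<and> C (X k) = C (X i). 1 / ?n * f (X k) / ?m k)"
  proof (rule sum.cong[OF refl])
    fix i assume "i \<in> control T"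
    \<comment> \<open>Within a stratum both \<open>f\<close> and the control count are constant, so
      they may be evaluated at \<open>k\<close> or at \<open>i\<close>.\<close>
    have "(\<Sum>k | k \<in> treated T \<and> C (X k) = C (X i). 1 / ?n * f (X k) / ?m k) =
        (\<Sum>k | k \<in> treated T \<and> C (X k) = C (X i). 1 / ?n * f (X i) / ?m i)"
      by (rule sum.cong) (auto dest: f)
    also have "\<dots> = cem_weights C T X i * f (X i)"
      using \<open>i \<in> control T\<close> by (simp add: cem_weights_def control_def treated_def)
    finally show "cem_weights C T X i * f (X i) =
      (\<Sum>k | k \<in> treated T \<and> C (X k) = C (X i). 1 / ?n * f (X k) / ?m k)" ..
  qed
  also have "\<dots> = (\<Sum>k\<in>treated T. \<Sum>i | i \<in> control T \<and> C (X k) = C (X i).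
      1 / ?n * f (X k) / ?m k)"
    by (rule sum.swap_restrict) auto
  also have "\<dots> = (\<Sum>k\<in>treated T. 1 / ?n * f (X k))"
  proof (rule sum.cong[OF refl])
    fix k assume "k \<in> treated T"
    then have "{i \<in> control T. C (X i) = C (X k)} \<noteq> {}"
      using ne by (auto simp: no_extrapolation_def)
    \<comment> \<open>Without a control in the stratum of \<open>k\<close> the inner sum would be
      empty and the contribution of \<open>k\<close> lost.\<close>
    then have "?m k \<noteq> 0"
      by simp
    then show "(\<Sum>i | i \<in> control T \<and> C (X k) = C (X i). 1 / ?n * f (X k) / ?m k) =
        1 / ?n * f (X k)"
      by (simp add: eq_commute[of "C (X k)"])
  qed
  finally show ?thesis
    by (simp add: sum_distrib_left)
qed

text \<open>The summation formula for the constant function 1 gives total control weight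
  one.\<close>

lemma cem_weights_allowable:
  fixes T :: "'i::finite \<Rightarrow> bool"
  assumes "treated T \<noteq> {}" "no_extrapolation C T X"
  shows "cem_weights C T X \<in> allowable_weights T (probability_weights T)"
  using sum_cem_weights[OF assms(2), of "\<lambda>_. 1"] assms(1)
  by (simp add: allowable_probability_weights_iff) (simp add: cem_weights_def)

section \<open>Minimizers of the dual norm\<close>

context coarsening
begin

lemma error_dual_norm_nonneg: "0 \<le> error_dual_norm F N T X W"
  unfolding error_dual_norm_def
proof (rule SUP_upper2)
  show "(\<lambda>_. 0) \<in> {f \<in> F. N f \<le> 1}"
    using zero_mem by (simp add: stratum_norm_def)
qed (simp add: matching_error_def)

lemma error_dual_norm_cem:
  fixes T :: "'i::finite \<Rightarrow> bool"
  assumes "no_extrapolation C T X"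
  shows "error_dual_norm F N T X (cem_weights C T X) = 0"
proof (rule antisym[OF _ error_dual_norm_nonneg])
  have "matching_error T X (cem_weights C T X) f = 0" if "f \<in> F" for f
  proof -
    have const: "f x = f y" if "C x = C y" for x y
      using \<open>f \<in> F\<close> that unfolding mem_iff by blast
    have "(\<Sum>i\<in>control T. cem_weights C T X i * f (X i)) =
        1 / real (card (treated T)) * (\<Sum>k\<in>treated T. f (X k))"
      by (rule sum_cem_weights[OF assms const])
    then show ?thesis
      by (simp add: matching_error_def)
  qed
  then show "error_dual_norm F N T X (cem_weights C T X) \<le> 0"
    by (auto simp: error_dual_norm_def intro: SUP_least)
qed

text \<open>CEM is allowable and attains the lower bound 0, so 0 is the minimum value.\<close>

lemma dual_norm_minimizers_eq:
  fixes T :: "'i::finite \<Rightarrow> bool"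
  assumes "treated T \<noteq> {}" "no_extrapolation C T X"
  shows "dual_norm_minimizers F N (probability_weights T) T X =
    {W \<in> allowable_weights T (probability_weights T). error_dual_norm F N T X W = 0}"
proof -
  let ?A = "allowable_weights T (probability_weights T)" and ?e = "error_dual_norm F N T X"
  have "is_arg_min ?e (\<lambda>W. W \<in> ?A) W \<longleftrightarrow> W \<in> ?A \<and> ?e W = 0" for W
  proof
    assume *: "is_arg_min ?e (\<lambda>W. W \<in> ?A) W"
    then have "?e W \<le> ?e (cem_weights C T X)"
      using cem_weights_allowable[OF assms] unfolding is_arg_min_linorder by blast
    then have "?e W = 0"
      unfolding error_dual_norm_cem[OF assms(2)] by (rule antisym[OF _ error_dual_norm_nonneg])
    then show "W \<in> ?A \<and> ?e W = 0"
      using * unfolding is_arg_min_def by blast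
  next
    assume "W \<in> ?A \<and> ?e W = 0"
    then show "is_arg_min ?e (\<lambda>W. W \<in> ?A) W"
      unfolding is_arg_min_linorder by (metis error_dual_norm_nonneg)
  qed
  then show ?thesis
    unfolding dual_norm_minimizers_def by blast
qed

lemma dual_norm_minimizers_neq_allowable:
  fixes T :: "'i::finite \<Rightarrow> bool"
  assumes ij: "i \<in> control T" "j \<in> control T" "C (X i) \<noteq> C (X j)"
  assumes T: "treated T \<noteq> {}" and ne: "no_extrapolation C T X"
  shows "dual_norm_minimizers F N (probability_weights T) T X \<noteq>
    allowable_weights T (probability_weights T)"
proof
  assume eq: "dual_norm_minimizers F N (probability_weights T) T X =
    allowable_weights T (probability_weights T)"
  define f where "f = (\<lambda>x. if C x = C (X i) then 1 else 0 :: real)"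
  have f: "f \<in> F" "(\<lambda>x. - f x) \<in> F"
    \<comment> \<open>Both signs of the indicator lie in the unit ball, so a vanishing one-sided
      supremum forces the error at \<open>f\<close> to be zero.\<close>
    by (simp_all add: mem_iff f_def)
  have Nf: "N f \<le> 1" "N (\<lambda>x. - f x) \<le> 1"
    using norm_le_iff[OF f(1), of 1] norm_le_iff[OF f(2), of 1] by (simp_all add: f_def)
  \<comment> \<open>On the controls \<open>\<delta> k\<close> is the point mass at \<open>k\<close>;
    the treated entries have the value prescribed for every allowable vector.\<close>
  define \<delta> where "\<delta> = (\<lambda>k l. if l \<in> treated T then 1 / real (card (treated T))
    else if l = k then 1 else 0 :: real)"
  have \<delta>_sum: "(\<Sum>l\<in>control T. \<delta> k l * g l) = g k" if "k \<in> control T" for k and g :: "'i \<Rightarrow> real"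
  proof -
    have "(\<Sum>l\<in>control T. \<delta> k l * g l) = (\<Sum>l\<in>control T. if l = k then g l else 0)"
      by (rule sum.cong) (auto simp: \<delta>_def control_def treated_def)
    then show ?thesis
      using that by simp
  qed
  have error0: "matching_error T X (\<delta> k) f = 0" if k: "k \<in> control T" for k
  proof -
    have "\<delta> k \<in> allowable_weights T (probability_weights T)"
      using \<delta>_sum[OF k, of "\<lambda>_. 1"]
      by (simp add: allowable_probability_weights_iff) (simp add: \<delta>_def)
    then have "error_dual_norm F N T X (\<delta> k) = 0"
      using eq dual_norm_minimizers_eq[OF T ne] by blast
    then have "(SUP g\<in>{g \<in> F. N g \<le> 1}. ereal (matching_error T X (\<delta> k) g)) \<le> 0"
      by (simp add: error_dual_norm_def)
    then have "\<forall>g\<in>{g \<in> F. N g \<le> 1}. ereal (matching_error T X (\<delta> k) g) \<le> 0"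
      by (simp only: SUP_le_iff)
    then have "matching_error T X (\<delta> k) f \<le> 0" "matching_error T X (\<delta> k) (\<lambda>x. - f x) \<le> 0"
      using f Nf by (simp_all add: zero_ereal_def)
    then show ?thesis
      by (simp add: matching_error_uminus)
  qed
  \<comment> \<open>The treated average does not depend on the weights, and zero error for each
    point mass makes it equal to both values.\<close>
  have "f (X i) = f (X j)"
    using error0[OF ij(1)] error0[OF ij(2)] \<delta>_sum[OF ij(1), of "\<lambda>l. f (X l)"]
      \<delta>_sum[OF ij(2), of "\<lambda>l. f (X l)"] unfolding matching_error_def by linarith
  then show False
    using ij(3) by (simp add: f_def)
qed

end

theorem theorem4:
  fixes M :: nat
    and C :: "'x \<Rightarrow> nat"
    and T :: "'i::finite \<Rightarrow> bool"
    and X :: "'i \<Rightarrow> 'x"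
  assumes coarsening: "\<And>x. C x \<in> {1..M}"
    and treated_nonempty: "treated T \<noteq> {}"
    and control_nonempty: "control T \<noteq> {}"
    and no_extrapolation: "no_extrapolation C T X"
  shows "dual_norm_setting (stratum_functions M C) (stratum_norm M C) (probability_weights T) T X \<and>
    cem_weights C T X \<in>
      dual_norm_minimizers (stratum_functions M C) (stratum_norm M C) (probability_weights T) T X \<and>
    (controls_in_two_strata C T X \<longrightarrow>
      ednm (stratum_functions M C) (stratum_norm M C) (probability_weights T) T X
        (cem_weights C T X))"
proof -
  interpret coarsening M C
    by unfold_locales (rule coarsening)
  have "cem_weights C T X \<in> dual_norm_minimizers F N (probability_weights T) T X"
    using treated_nonempty no_extrapolation
    by (simp add: dual_norm_minimizers_eq cem_weights_allowable error_dual_norm_cem)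
  moreover have "dual_norm_minimizers F N (probability_weights T) T X \<noteq>
      allowable_weights T (probability_weights T)" if "controls_in_two_strata C T X"
    using that dual_norm_minimizers_neq_allowable[OF _ _ _ treated_nonempty no_extrapolation]
    unfolding controls_in_two_strata_def by blast
  ultimately show ?thesis
    using dual_norm_setting[OF treated_nonempty] unfolding ednm_def by blast
qed

end
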